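(* Let $k$ be a field of characteristic zero and let $A$ be the algebra of formal power series over $k$ in the noncommutative variables $X,Y$. For every integer $n>2$, we have $$\langle X,Y\rangle_n=\langle X,Y\rangle^0_n+\langle X,Y\rangle^1_n,$$ where $\langle X,Y\rangle^0_n,\langle X,Y\rangle^1_n\in A$ are determined by $$\bigl(2^n-(-1)^n-3\bigr)\langle X,Y\rangle^0_n=\sum_{\substack{1<m<n\\ m\equiv n \bmod 2}}\Bigl(\pi_n\bigl\langle X,\langle\langle X,Y\rangle,Y\rangle\bigr\rangle_m-\pi_n\bigl\langle X,\langle\langle Y,X\rangle,Y\rangle\bigr\rangle_m\Bigr),$$ $$\bigl(2^n-(-1)^n-3\bigr)\langle X,Y\rangle^1_n=\sum_{\substack{1<m<n\\ m\equiv n+1 \bmod 2}}\Bigl(2W_{n,m}(X,Y)+(-1)^{n+1}W_{n,m}(2Y,X)\Bigr).$$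
   Context: $k$ is a field of characteristic zero; $A$ is the associative $k$-algebra of formal power series in two noncommutative variables $X,Y$; $A^{X,Y}\subset A$ is the ideal generated by $X,Y$ (the series with zero constant term). For $f\in A$ and $a,b\in A^{X,Y}$, the composite $f(a,b)$ (substitute $a$ for $X$ and $b$ for $Y$) is well defined. $\langle X,Y\rangle=\log(e^Xe^Y)\in A^{X,Y}$, and $\langle X,Y\rangle_m$ denotes its homogeneous term of degree $m$, so $\langle X,Y\rangle=\sum_{m\ge1}\langle X,Y\rangle_m$ and $\langle X,Y\rangle_1=X+Y$. For $a,b\in A^{X,Y}$, $\langle a,b\rangle=\log(e^ae^b)\in A^{X,Y}$ and $\langle a,b\rangle_m$ are the composites of $\langle X,Y\rangle$ and $\langle X,Y\rangle_m$ with $a,b$ (so $\langle a,b\rangle_m$ need not be homogeneous of degree $m$ in $X,Y$). For $a\in A^{X,Y}$ and $n\ge1$, $\pi_n a$ denotes the homogeneous term of $a$ of degree $n$ in $X,Y$. For $1\le m\le n$, $W_{n,m}(X,Y)=\pi_n\bigl\langle\langle X,Y\rangle,Y\bigr\rangle_m$, a polynomial in $X,Y$; $W_{n,m}(2Y,X)$ is obtained from it by simultaneously substituting $2Y$ for $X$ and $X$ for $Y$. Empty sums are zero. The integer $2^n-(-1)^n-3$ is nonzero for $n>2$. *)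

theory Defs
  imports
    "HOL-Computational_Algebra.Formal_Power_Series"
    "HOL-Number_Theory.Cong"
begin

section \<open>Formal power series in two noncommuting variables\<close>

datatype nc_var = VX | VY

text \<open>A series is the family of its coefficients, indexed by the words in the two letters.\<close>

typedef 'a ncfps = "UNIV :: (nc_var list \<Rightarrow> 'a) set"
  morphisms nc_nth Abs_ncfps
  by simp

declare Abs_ncfps_inverse [OF UNIV_I, simp]

lemma ncfps_eqI: "(\<And>w. nc_nth f w = nc_nth g w) \<Longrightarrow> f = g"
  by (metis ext nc_nth_inject)

instantiation ncfps :: (ring_1) ring_1
begin

definition zero_ncfps :: "'a ncfps"
  where "0 = Abs_ncfps (\<lambda>w. 0)"

definition one_ncfps :: "'a ncfps"
  where "1 = Abs_ncfps (\<lambda>w. if w = [] then 1 else 0)"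

definition plus_ncfps :: "'a ncfps \<Rightarrow> 'a ncfps \<Rightarrow> 'a ncfps"
  where "f + g = Abs_ncfps (\<lambda>w. nc_nth f w + nc_nth g w)"

definition minus_ncfps :: "'a ncfps \<Rightarrow> 'a ncfps \<Rightarrow> 'a ncfps"
  where "f - g = Abs_ncfps (\<lambda>w. nc_nth f w - nc_nth g w)"

definition uminus_ncfps :: "'a ncfps \<Rightarrow> 'a ncfps"
  where "- f = Abs_ncfps (\<lambda>w. - nc_nth f w)"

text \<open>The pairs \<open>(take i w, drop i w)\<close> are all factorisations of \<open>w\<close> into two words.\<close>

definition times_ncfps :: "'a ncfps \<Rightarrow> 'a ncfps \<Rightarrow> 'a ncfps"
  where "f * g = Abs_ncfps (\<lambda>w. \<Sum>i=0..length w. nc_nth f (take i w) * nc_nth g (drop i w))"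

instance
proof
  fix a b c :: "'a ncfps"
  show "a + b + c = a + (b + c)" "a + b = b + a" "0 + a = a" "- a + a = 0" "a - b = a + - b"
    by (simp_all add: plus_ncfps_def minus_ncfps_def uminus_ncfps_def zero_ncfps_def
        ac_simps nc_nth_inverse)
  show "(0::'a ncfps) \<noteq> 1"
  proof
    assume "(0::'a ncfps) = 1"
    hence "nc_nth (0::'a ncfps) [] = nc_nth 1 []" by simp
    thus False by (simp add: zero_ncfps_def one_ncfps_def)
  qed
  show "(a + b) * c = a * c + b * c" "a * (b + c) = a * b + a * c"
    by (rule ncfps_eqI, simp add: plus_ncfps_def times_ncfps_def algebra_simps sum.distrib)+
  show "1 * a = a"
  proof (rule ncfps_eqI)
    fix w
    have "nc_nth (1 * a) w =
        (\<Sum>i=0..length w. if i = 0 then nc_nth a (drop i w) else 0)"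
      unfolding times_ncfps_def one_ncfps_def Abs_ncfps_inverse [OF UNIV_I]
      by (rule sum.cong) auto
    thus "nc_nth (1 * a) w = nc_nth a w" by (simp add: sum.delta)
  qed
  show "a * 1 = a"
  proof (rule ncfps_eqI)
    fix w
    have "nc_nth (a * 1) w =
        (\<Sum>i=0..length w. if i = length w then nc_nth a (take i w) else 0)"
      unfolding times_ncfps_def one_ncfps_def Abs_ncfps_inverse [OF UNIV_I]
      by (rule sum.cong) auto
    thus "nc_nth (a * 1) w = nc_nth a w" by (simp add: sum.delta)
  qed
  show "a * b * c = a * (b * c)"
  proof (rule ncfps_eqI)
    fix w
    define F where "F = (\<lambda>p q (r::nat). nc_nth a (take p w) *
      (nc_nth b (take q (drop p w)) * nc_nth c (drop (p + q) w)))"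
    have "nc_nth (a * b * c) w = (\<Sum>j=0..length w. \<Sum>i=0..j. F i (j - i) (length w - j))"
      unfolding times_ncfps_def F_def
      by (auto simp: sum_distrib_right mult.assoc min_def drop_take intro!: sum.cong split: if_splits)
    also have "\<dots> = (\<Sum>j=0..length w. \<Sum>i=0..length w - j. F j i (length w - j - i))"
      by (rule fps_mult_assoc_lemma)
    also have "\<dots> = nc_nth (a * (b * c)) w"
      unfolding times_ncfps_def F_def
      by (auto simp: sum_distrib_left add.commute intro!: sum.cong)
    finally show "nc_nth (a * b * c) w = nc_nth (a * (b * c)) w" .
  qed
qed

end

lemma nc_nth_simps [simp]:
  "nc_nth 0 w = 0"
  "nc_nth 1 w = (if w = [] then 1 else 0)"
  "nc_nth (f + g) w = nc_nth f w + nc_nth g w"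
  "nc_nth (f - g) w = nc_nth f w - nc_nth g w"
  "nc_nth (- f) w = - nc_nth f w"
  by (simp_all add: zero_ncfps_def one_ncfps_def plus_ncfps_def minus_ncfps_def uminus_ncfps_def)

lemma nc_nth_mult:
  "nc_nth (f * g) w = (\<Sum>i=0..length w. nc_nth f (take i w) * nc_nth g (drop i w))"
  by (simp add: times_ncfps_def)

definition ncX :: "'a::ring_1 ncfps"
  where "ncX = Abs_ncfps (\<lambda>w. if w = [VX] then 1 else 0)"

definition ncY :: "'a::ring_1 ncfps"
  where "ncY = Abs_ncfps (\<lambda>w. if w = [VY] then 1 else 0)"

definition nc_hom :: "nat \<Rightarrow> 'a::ring_1 ncfps \<Rightarrow> 'a ncfps"
  where "nc_hom n f = Abs_ncfps (\<lambda>w. if length w = n then nc_nth f w else 0)"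


section \<open>Substitution\<close>

fun nc_word_eval :: "'a::ring_1 ncfps \<Rightarrow> 'a ncfps \<Rightarrow> nc_var list \<Rightarrow> 'a ncfps"
  where
    "nc_word_eval a b [] = 1"
  | "nc_word_eval a b (VX # u) = a * nc_word_eval a b u"
  | "nc_word_eval a b (VY # u) = b * nc_word_eval a b u"

text \<open>
  The next three operations are meant for arguments \<open>a\<close>, \<open>b\<close> with zero constant term
  (for \<open>nc_log\<close>: constant term one). Then a product of more than
  \<open>length w\<close> such factors has coefficient zero at \<open>w\<close> (see \<open>nc_word_eval_eq_0\<close>
  and \<open>nc_power_eq_0\<close>), so the finite sums below are the full coefficients of
  \<open>f(a,b)\<close> and \<open>F(a)\<close>.
\<close>

definition nc_subst :: "'a::ring_1 ncfps \<Rightarrow> 'a ncfps \<Rightarrow> 'a ncfps \<Rightarrow> 'a ncfps"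
  where "nc_subst f a b = Abs_ncfps (\<lambda>w.
    \<Sum>u | length u \<le> length w. nc_nth f u * nc_nth (nc_word_eval a b u) w)"

definition fps_nc_compose :: "'a::ring_1 fps \<Rightarrow> 'a ncfps \<Rightarrow> 'a ncfps"
  where "fps_nc_compose F a = Abs_ncfps (\<lambda>w.
    \<Sum>i\<le>length w. fps_nth F i * nc_nth (a ^ i) w)"

definition nc_exp :: "'a::field_char_0 ncfps \<Rightarrow> 'a ncfps"
  where "nc_exp a = fps_nc_compose (fps_exp 1) a"

text \<open>\<open>fps_ln 1\<close> is the series of \<open>log (1 + t)\<close>.\<close>

definition nc_log :: "'a::field_char_0 ncfps \<Rightarrow> 'a ncfps"
  where "nc_log g = fps_nc_compose (fps_ln 1) (g - 1)"

lemma nc_mult_eq_0: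
  assumes "nc_nth a [] = 0" "\<And>v. length v < m \<Longrightarrow> nc_nth f v = 0" "length w < Suc m"
  shows "nc_nth (a * f) w = 0"
  unfolding nc_nth_mult
proof (rule sum.neutral, rule ballI)
  fix i assume i: "i \<in> {0..length w}"
  show "nc_nth a (take i w) * nc_nth f (drop i w) = 0"
  proof (cases "i = 0")
    case False
    hence "length (drop i w) < m" using i assms(3) by auto
    thus ?thesis using assms(2) by simp
  qed (simp add: assms(1))
qed

lemma nc_word_eval_eq_0:
  assumes "nc_nth a [] = 0" "nc_nth b [] = 0" "length w < length u"
  shows "nc_nth (nc_word_eval a b u) w = 0"
  using assms(3)
proof (induction u arbitrary: w)
  case (Cons x u)
  show ?case
    by (cases x) (use Cons assms in \<open>auto intro!: nc_mult_eq_0[where m = "length u"]\<close>)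
qed simp

lemma nc_power_eq_0:
  assumes "nc_nth a [] = 0" "length w < i"
  shows "nc_nth (a ^ i) w = 0"
  using assms(2)
proof (induction i arbitrary: w)
  case (Suc i)
  show ?case
    unfolding power_Suc by (rule nc_mult_eq_0[where m = i]) (use Suc assms in auto)
qed simp


section \<open>Baker--Campbell--Hausdorff series\<close>

definition nc_bch :: "'a::field_char_0 ncfps \<Rightarrow> 'a ncfps \<Rightarrow> 'a ncfps"
  where "nc_bch a b = nc_log (nc_exp a * nc_exp b)"

text \<open>The composite of the degree \<open>m\<close> term of \<open>log (e^X e^Y)\<close> with \<open>a\<close>, \<open>b\<close>;
  this is not \<open>nc_hom m (nc_bch a b)\<close> in general.\<close>

definition nc_bch_term :: "nat \<Rightarrow> 'a::field_char_0 ncfps \<Rightarrow> 'a ncfps \<Rightarrow> 'a ncfps"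
  where "nc_bch_term m a b = nc_subst (nc_hom m (nc_bch ncX ncY)) a b"

definition nc_W :: "nat \<Rightarrow> nat \<Rightarrow> 'a::field_char_0 ncfps"
  where "nc_W n m = nc_hom n (nc_bch_term m (nc_bch ncX ncY) ncY)"

lemma nc_bch_constant: "nc_nth (nc_bch a b) [] = 0"
  by (simp add: nc_bch_def nc_log_def fps_nc_compose_def)


section \<open>Integer multiples\<close>

lemma nc_nth_of_int_mult:
  "nc_nth (of_int c * f) w = of_int c * nc_nth (f :: 'a::ring_1 ncfps) w"
proof -
  have *: "nc_nth (of_nat m * f) w = of_nat m * nc_nth f w" for m
    by (induction m) (simp_all add: algebra_simps)
  show ?thesis
    by (cases c rule: int_cases2) (simp_all add: *)
qed

lemma bch_factor_nonzero:
  assumes "n > 2"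
  shows "(2::int) ^ n - (-1) ^ n - 3 \<noteq> 0"
proof -
  have "(2::int) ^ 3 \<le> 2 ^ n" using assms by (intro power_increasing) auto
  moreover have "(-1::int) ^ n = 1 \<or> (-1::int) ^ n = -1"
    by (cases "even n") auto
  ultimately show ?thesis by auto
qed

text \<open>Hence an equation \<open>(2^n - (-1)^n - 3) Z = S\<close> does determine \<open>Z\<close>.\<close>

lemma bch_factor_ex1:
  fixes S :: "'a::field_char_0 ncfps"
  assumes "n > 2"
  shows "\<exists>!Z. of_int (2 ^ n - (-1) ^ n - 3) * Z = S"
proof -
  define c :: int where "c = 2 ^ n - (-1) ^ n - 3"
  have c: "(of_int c :: 'a) \<noteq> 0"
    using bch_factor_nonzero[OF assms] unfolding c_def of_int_eq_0_iff .
  have "\<exists>!Z. of_int c * Z = S"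
  proof
    show "of_int c * Abs_ncfps (\<lambda>w. nc_nth S w / of_int c) = S"
      using c by (intro ncfps_eqI) (simp add: nc_nth_of_int_mult)
  next
    fix Z assume "of_int c * Z = S"
    thus "Z = Abs_ncfps (\<lambda>w. nc_nth S w / of_int c)"
      using c by (intro ncfps_eqI) (auto simp: nc_nth_of_int_mult)
  qed
  thus ?thesis unfolding c_def .
qed

end

theory Submission
  imports Defs
begin

text \<open>
  Write \<open>T = \<langle>X,Y\<rangle>\<close>. By associativity \<open>\<langle>X,\<langle>\<langle>X,Y\<rangle>,Y\<rangle>\<rangle> = \<langle>2X,2Y\<rangle>\<close> and
  \<open>\<langle>X,\<langle>\<langle>Y,X\<rangle>,Y\<rangle>\<rangle> = \<langle>T,T\<rangle> = 2T\<close>, whose degree \<open>n\<close> terms are \<open>2\<^sup>n T\<^sub>n\<close> and \<open>2 T\<^sub>n\<close>.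
  Let \<open>U\<^sub>m\<close> and \<open>V\<^sub>m\<close> be the contributions of \<open>\<langle>\<cdot>,\<cdot>\<rangle>\<^sub>m\<close> to these terms. As \<open>U\<^sub>n = V\<^sub>n\<close>, the difference
  expresses \<open>(2\<^sup>n - 2) T\<^sub>n\<close> through \<open>U\<^sub>1 - V\<^sub>1\<close> and \<open>U\<^sub>m - V\<^sub>m\<close> with \<open>1 < m < n\<close>. The reversal symmetry
  \<open>\<langle>-b,-a\<rangle> = -\<langle>a,b\<rangle>\<close> gives \<open>U\<^sub>m = (-1)\<^sup>n\<^sup>+\<^sup>1 W\<^sub>n\<^sub>,\<^sub>m(2Y,X)\<close>, and \<open>V\<^sub>m = 0\<close> unless \<open>m \<equiv> n\<close> mod 2,
  because \<open>\<langle>\<langle>Y,X\<rangle>,Y\<rangle>\<close> is a palindrome. Finally \<open>U\<^sub>1 - V\<^sub>1\<close> is the degree \<open>n\<close> term of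
  \<open>\<langle>T,Y\<rangle> + (-1)\<^sup>n \<langle>Y,T\<rangle>\<close>, which is twice the sum of the \<open>W\<^sub>n\<^sub>,\<^sub>m\<close> with \<open>m \<equiv> n + 1\<close> mod 2; for even \<open>n\<close>
  this includes \<open>m = 1\<close>, that is \<open>W\<^sub>n\<^sub>,\<^sub>1 = T\<^sub>n\<close>, whence the coefficient \<open>2\<^sup>n - 2 - (1 + (-1)\<^sup>n)\<close>.
\<close>

section \<open>Substitution is a continuous ring homomorphism\<close>

lemma finite_nc_words [simp]: "finite {u :: nc_var list. length u \<le> N}"
proof -
  have "(UNIV :: nc_var set) \<subseteq> {VX, VY}"
    by (auto intro: nc_var.exhaust)
  hence "finite (UNIV :: nc_var set)"
    by (rule finite_subset) simp
  from finite_lists_length_le[OF this] show ?thesis by simp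
qed

lemma nc_nth_sum: "nc_nth (sum f S) w = (\<Sum>x\<in>S. nc_nth (f x) w)"
  by (induction S rule: infinite_finite_induct) auto

lemma nc_nth_mult_Nil [simp]: "nc_nth (f * g) [] = nc_nth f [] * nc_nth g []"
  by (simp add: nc_nth_mult)

lemma nc_nth_Nil_of_int_mult [simp]:
  "nc_nth a [] = 0 \<Longrightarrow> nc_nth (of_int c * a) [] = (0 :: 'a::ring_1)"
  by (simp add: nc_nth_of_int_mult)

lemma nc_nth_ncX [simp]: "nc_nth ncX w = (if w = [VX] then 1 else 0)"
  and nc_nth_ncY [simp]: "nc_nth ncY w = (if w = [VY] then 1 else 0)"
  by (simp_all add: ncX_def ncY_def)

lemma nc_nth_hom [simp]: "nc_nth (nc_hom n f) w = (if length w = n then nc_nth f w else 0)"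
  by (simp add: nc_hom_def)

lemma nc_word_eval_append:
  "nc_word_eval a b (u @ v) = nc_word_eval a b u * nc_word_eval a b v"
  by (induction a b u rule: nc_word_eval.induct) (simp_all add: mult.assoc)

text \<open>Longer words evaluate to series that vanish at \<open>w\<close>, so any bound
  \<open>N\<close> may serve as cutoff. A common cutoff for all pieces of one word is what allows
  the sums to be interchanged later.\<close>

lemma nc_nth_subst:
  assumes "nc_nth a [] = 0" "nc_nth b [] = 0" "length w \<le> N"
  shows "nc_nth (nc_subst f a b) w =
    (\<Sum>u | length u \<le> N. nc_nth f u * nc_nth (nc_word_eval a b u) w)"
  unfolding nc_subst_def Abs_ncfps_inverse[OF UNIV_I]
  by (rule sum.mono_neutral_left) (use assms in \<open>auto simp: nc_word_eval_eq_0\<close>)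

lemma nc_nth_subst_Nil [simp]: "nc_nth (nc_subst f a b) [] = nc_nth f []"
  by (simp add: nc_subst_def)

lemma nc_subst_0 [simp]: "nc_subst 0 a b = 0"
  and nc_subst_add: "nc_subst (f + g) a b = nc_subst f a b + nc_subst g a b"
  and nc_subst_diff: "nc_subst (f - g) a b = nc_subst f a b - nc_subst g a b"
  by (rule ncfps_eqI,
      simp add: nc_subst_def sum.distrib sum_subtractf algebra_simps)+

lemma nc_subst_single:
  assumes "nc_nth a [] = 0" "nc_nth b [] = 0" "\<And>u. nc_nth f u = (if u = v then 1 else 0)"
  shows "nc_subst f a b = nc_word_eval a b v"
proof (rule ncfps_eqI)
  fix w
  have "nc_nth (nc_subst f a b) w =
      (\<Sum>u | length u \<le> length w. if u = v then nc_nth (nc_word_eval a b v) w else 0)"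
    unfolding nc_subst_def Abs_ncfps_inverse[OF UNIV_I]
    by (rule sum.cong) (auto simp: assms(3))
  also have "\<dots> = nc_nth (nc_word_eval a b v) w"
    using nc_word_eval_eq_0[OF assms(1,2), of w v] by (simp add: sum.delta)
  finally show "nc_nth (nc_subst f a b) w = nc_nth (nc_word_eval a b v) w" .
qed

lemma nc_subst_1: "nc_nth a [] = 0 \<Longrightarrow> nc_nth b [] = 0 \<Longrightarrow> nc_subst 1 a b = 1"
  using nc_subst_single[of a b 1 "[]"] by simp

lemma nc_subst_ncX: "nc_nth a [] = 0 \<Longrightarrow> nc_nth b [] = 0 \<Longrightarrow> nc_subst ncX a b = a"
  and nc_subst_ncY: "nc_nth a [] = 0 \<Longrightarrow> nc_nth b [] = 0 \<Longrightarrow> nc_subst ncY a b = b"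
  using nc_subst_single[of a b ncX "[VX]"] nc_subst_single[of a b ncY "[VY]"] by simp_all

text \<open>Evaluation turns concatenation into multiplication, so both sides are sums over pairs of
  words \<open>p\<close>, \<open>q\<close>. Commuting coefficients let those of \<open>g\<close>
  pass the evaluation of \<open>p\<close>.\<close>

lemma nc_subst_mult:
  fixes f g a b :: "'a::comm_ring_1 ncfps"
  assumes a: "nc_nth a [] = 0" and b: "nc_nth b [] = 0"
  shows "nc_subst (f * g) a b = nc_subst f a b * nc_subst g a b"
proof (rule ncfps_eqI)
  fix w :: "nc_var list"
  define N where "N = length w"
  define L where "L = {u :: nc_var list. length u \<le> N}"
  define E where "E = nc_word_eval a b"
  have fin: "finite L" by (simp add: L_def)
  have "nc_nth (nc_subst (f * g) a b) w = (\<Sum>u\<in>L. \<Sum>i=0..length u.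
      nc_nth f (take i u) * nc_nth g (drop i u) * nc_nth (E u) w)"
    by (simp add: nc_subst_def nc_nth_mult sum_distrib_right L_def N_def E_def)
  also have "\<dots> = (\<Sum>(u, i)\<in>Sigma L (\<lambda>u. {0..length u}).
      nc_nth f (take i u) * nc_nth g (drop i u) * nc_nth (E u) w)"
    using fin by (simp add: sum.Sigma)
  also have "\<dots> = (\<Sum>(p, q) | length (p @ q) \<le> N. nc_nth f p * nc_nth g q * nc_nth (E (p @ q)) w)"
    by (rule sum.reindex_bij_witness[where
          i = "\<lambda>(p, q). (p @ q, length p)" and j = "\<lambda>(u, i). (take i u, drop i u)"])
      (auto simp: L_def)
  \<comment> \<open>Over the full square the sums over \<open>p\<close> and \<open>q\<close>
    decouple; the added pairs have \<open>p @ q\<close> longer than \<open>w\<close> and contribute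
    zero.\<close>
  also have "\<dots> = (\<Sum>(p, q)\<in>L \<times> L. nc_nth f p * nc_nth g q * nc_nth (E (p @ q)) w)"
  proof (rule sum.mono_neutral_left)
    show "finite (L \<times> L)" using fin by simp
    show "{(p, q). length (p @ q) \<le> N} \<subseteq> L \<times> L" by (auto simp: L_def)
    show "\<forall>x\<in>L \<times> L - {(p, q). length (p @ q) \<le> N}.
        (case x of (p, q) \<Rightarrow> nc_nth f p * nc_nth g q * nc_nth (E (p @ q)) w) = 0"
      by (auto simp: N_def E_def)
        (metis a b length_append mult_zero_right nc_word_eval_eq_0 not_le)
  qed
  also have "\<dots> = (\<Sum>p\<in>L. \<Sum>q\<in>L. \<Sum>j=0..N.
      (nc_nth f p * nc_nth (E p) (take j w)) * (nc_nth g q * nc_nth (E q) (drop j w)))"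
    unfolding sum.cartesian_product[symmetric] E_def nc_word_eval_append
    by (simp add: nc_nth_mult sum_distrib_left N_def mult_ac)
  also have "\<dots> = (\<Sum>j=0..N. \<Sum>p\<in>L. \<Sum>q\<in>L.
      (nc_nth f p * nc_nth (E p) (take j w)) * (nc_nth g q * nc_nth (E q) (drop j w)))"
    by (rule trans[OF sum.cong[OF refl sum.swap] sum.swap])
  also have "\<dots> = nc_nth (nc_subst f a b * nc_subst g a b) w"
    unfolding nc_nth_mult sum_product[symmetric]
    by (rule sum.cong) (auto simp: N_def L_def E_def nc_nth_subst[OF a b, of _ "length w"])
  finally show "nc_nth (nc_subst (f * g) a b) w = nc_nth (nc_subst f a b * nc_subst g a b) w" .
qed

lemma nc_subst_power:
  fixes f a b :: "'a::comm_ring_1 ncfps"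
  assumes "nc_nth a [] = 0" "nc_nth b [] = 0"
  shows "nc_subst (f ^ i) a b = nc_subst f a b ^ i"
  by (induction i) (simp_all add: nc_subst_1 nc_subst_mult assms)

lemma nc_subst_word_eval:
  fixes a b c d :: "'a::comm_ring_1 ncfps"
  assumes "nc_nth c [] = 0" "nc_nth d [] = 0"
  shows "nc_subst (nc_word_eval a b u) c d = nc_word_eval (nc_subst a c d) (nc_subst b c d) u"
proof (induction u)
  case (Cons x u)
  thus ?case by (cases x) (simp_all add: nc_subst_mult assms)
qed (simp add: nc_subst_1 assms)

lemma nc_subst_subst:
  fixes f a b c d :: "'a::comm_ring_1 ncfps"
  assumes "nc_nth a [] = 0" "nc_nth b [] = 0" "nc_nth c [] = 0" "nc_nth d [] = 0"
  shows "nc_subst (nc_subst f a b) c d = nc_subst f (nc_subst a c d) (nc_subst b c d)"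
proof (rule ncfps_eqI)
  fix w :: "nc_var list"
  let ?L = "{u :: nc_var list. length u \<le> length w}"
  have "nc_nth (nc_subst (nc_subst f a b) c d) w = (\<Sum>v\<in>?L. \<Sum>u\<in>?L.
      nc_nth f u * (nc_nth (nc_word_eval a b u) v * nc_nth (nc_word_eval c d v) w))"
    by (simp add: nc_nth_subst[OF assms(3,4), of w "length w"]
        nc_nth_subst[OF assms(1,2), of _ "length w"] sum_distrib_right mult.assoc)
  also have "\<dots> = (\<Sum>u\<in>?L. nc_nth f u * (\<Sum>v\<in>?L.
      nc_nth (nc_word_eval a b u) v * nc_nth (nc_word_eval c d v) w))"
    by (subst sum.swap) (simp add: sum_distrib_left)
  also have "\<dots> = (\<Sum>u\<in>?L. nc_nth f u * nc_nth (nc_subst (nc_word_eval a b u) c d) w)"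
    by (simp add: nc_subst_def)
  also have "\<dots> = nc_nth (nc_subst f (nc_subst a c d) (nc_subst b c d)) w"
    by (simp add: nc_subst_word_eval assms nc_subst_def[of f])
  finally show "nc_nth (nc_subst (nc_subst f a b) c d) w =
    nc_nth (nc_subst f (nc_subst a c d) (nc_subst b c d)) w" .
qed

section \<open>Power series in one series without constant term\<close>

lemma nc_nth_compose:
  assumes "nc_nth a [] = 0" "length w \<le> N"
  shows "nc_nth (fps_nc_compose F a) w = (\<Sum>i\<le>N. fps_nth F i * nc_nth (a ^ i) w)"
  unfolding fps_nc_compose_def Abs_ncfps_inverse[OF UNIV_I]
  by (rule sum.mono_neutral_left) (use assms in \<open>auto simp: nc_power_eq_0\<close>)

lemma nc_nth_compose_Nil [simp]: "nc_nth (fps_nc_compose F a) [] = fps_nth F 0"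
  by (simp add: fps_nc_compose_def)

lemma nc_subst_compose:
  fixes a b c :: "'a::comm_ring_1 ncfps"
  assumes "nc_nth a [] = 0" "nc_nth b [] = 0" "nc_nth c [] = 0"
  shows "nc_subst (fps_nc_compose F c) a b = fps_nc_compose F (nc_subst c a b)"
proof (rule ncfps_eqI)
  fix w :: "nc_var list"
  let ?L = "{u :: nc_var list. length u \<le> length w}"
  have "nc_nth (nc_subst (fps_nc_compose F c) a b) w = (\<Sum>u\<in>?L. \<Sum>i\<le>length w.
      fps_nth F i * (nc_nth (c ^ i) u * nc_nth (nc_word_eval a b u) w))"
    by (simp add: nc_nth_subst[OF assms(1,2), of w "length w"]
        nc_nth_compose[OF assms(3), of _ "length w"] sum_distrib_right mult.assoc)
  also have "\<dots> = (\<Sum>i\<le>length w. fps_nth F i * nc_nth (nc_subst (c ^ i) a b) w)"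
    by (subst sum.swap) (simp add: sum_distrib_left nc_subst_def)
  also have "\<dots> = nc_nth (fps_nc_compose F (nc_subst c a b)) w"
    by (simp add: nc_subst_power assms fps_nc_compose_def)
  finally show "nc_nth (nc_subst (fps_nc_compose F c) a b) w =
    nc_nth (fps_nc_compose F (nc_subst c a b)) w" .
qed

lemma fps_nc_compose_1 [simp]: "fps_nc_compose 1 a = 1"
proof (rule ncfps_eqI)
  fix w
  have "nc_nth (fps_nc_compose 1 a) w = (\<Sum>i\<le>length w. if i = 0 then nc_nth (1 :: 'a ncfps) w else 0)"
    unfolding fps_nc_compose_def Abs_ncfps_inverse[OF UNIV_I] by (rule sum.cong) auto
  thus "nc_nth (fps_nc_compose 1 a) w = nc_nth (1 :: 'a ncfps) w" by (simp add: sum.delta)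
qed

lemma fps_nc_compose_X:
  fixes a :: "'a::ring_1 ncfps"
  assumes "nc_nth a [] = 0"
  shows "fps_nc_compose fps_X a = a"
proof (rule ncfps_eqI)
  fix w
  \<comment> \<open>The bound \<open>Suc (length w)\<close> keeps the exponent 1 in range even for
    the empty word.\<close>
  have "nc_nth (fps_nc_compose fps_X a) w = (\<Sum>i\<le>Suc (length w). if i = 1 then nc_nth a w else 0)"
    unfolding nc_nth_compose[OF assms, of w "Suc (length w)", OF le_SucI[OF order_refl]]
    by (rule sum.cong) auto
  thus "nc_nth (fps_nc_compose fps_X a) w = nc_nth a w"
    by (simp add: sum.delta del: sum.atMost_Suc)
qed

lemma fps_nc_compose_diff:
  "fps_nc_compose (F - G) a = fps_nc_compose F a - fps_nc_compose G a"
  by (rule ncfps_eqI) (simp add: fps_nc_compose_def sum_subtractf algebra_simps)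

text \<open>The argument of \<open>nc_subst_mult\<close> with exponents in place of words.\<close>

lemma fps_nc_compose_mult:
  fixes a :: "'a::comm_ring_1 ncfps"
  assumes a: "nc_nth a [] = 0"
  shows "fps_nc_compose (F * G) a = fps_nc_compose F a * fps_nc_compose G a"
proof (rule ncfps_eqI)
  fix w :: "nc_var list"
  define N where "N = length w"
  have "nc_nth (fps_nc_compose (F * G) a) w = (\<Sum>n\<le>N. \<Sum>i=0..n.
      fps_nth F i * fps_nth G (n - i) * nc_nth (a ^ n) w)"
    by (simp add: fps_nc_compose_def fps_mult_nth sum_distrib_right N_def)
  also have "\<dots> = (\<Sum>(n, i)\<in>Sigma {..N} (\<lambda>n. {0..n}).
      fps_nth F i * fps_nth G (n - i) * nc_nth (a ^ n) w)"
    by (simp add: sum.Sigma)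
  also have "\<dots> = (\<Sum>(i, j) | i + j \<le> N. fps_nth F i * fps_nth G j * nc_nth (a ^ (i + j)) w)"
    by (rule sum.reindex_bij_witness[where i = "\<lambda>(i, j). (i + j, i)" and j = "\<lambda>(n, i). (i, n - i)"])
      auto
  also have "\<dots> = (\<Sum>(i, j)\<in>{..N} \<times> {..N}. fps_nth F i * fps_nth G j * nc_nth (a ^ (i + j)) w)"
    by (rule sum.mono_neutral_left) (auto simp: N_def, metis a mult_zero_right nc_power_eq_0 not_le)
  also have "\<dots> = (\<Sum>i\<le>N. \<Sum>j\<le>N. \<Sum>l=0..N.
      (fps_nth F i * nc_nth (a ^ i) (take l w)) * (fps_nth G j * nc_nth (a ^ j) (drop l w)))"
    unfolding sum.cartesian_product[symmetric] power_add
    by (simp add: nc_nth_mult sum_distrib_left N_def mult_ac)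
  also have "\<dots> = (\<Sum>l=0..N. \<Sum>i\<le>N. \<Sum>j\<le>N.
      (fps_nth F i * nc_nth (a ^ i) (take l w)) * (fps_nth G j * nc_nth (a ^ j) (drop l w)))"
    by (rule trans[OF sum.cong[OF refl sum.swap] sum.swap])
  also have "\<dots> = nc_nth (fps_nc_compose F a * fps_nc_compose G a) w"
    unfolding nc_nth_mult sum_product[symmetric]
    by (rule sum.cong) (auto simp: N_def nc_nth_compose[OF a, of _ "length w"])
  finally show "nc_nth (fps_nc_compose (F * G) a) w =
    nc_nth (fps_nc_compose F a * fps_nc_compose G a) w" .
qed

lemma fps_nc_compose_power:
  fixes a :: "'a::comm_ring_1 ncfps"
  assumes "nc_nth a [] = 0"
  shows "fps_nc_compose (F ^ i) a = fps_nc_compose F a ^ i"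
  by (induction i) (simp_all add: fps_nc_compose_mult assms)

text \<open>Transfers identities between one-variable series. Since \<open>G\<close> has no constant
  term, \<open>G ^ i\<close> starts in degree at least \<open>i\<close>, so one bound on
  \<open>i\<close> serves all degrees up to \<open>length w\<close>.\<close>

lemma fps_nc_compose_compose:
  fixes a :: "'a::comm_ring_1 ncfps"
  assumes a: "nc_nth a [] = 0" and G: "fps_nth G 0 = 0"
  shows "fps_nc_compose (F oo G) a = fps_nc_compose F (fps_nc_compose G a)"
proof (rule ncfps_eqI)
  fix w :: "nc_var list"
  define N where "N = length w"
  have "nc_nth (fps_nc_compose (F oo G) a) w =
      (\<Sum>n\<le>N. (\<Sum>i\<le>N. fps_nth F i * fps_nth (G ^ i) n) * nc_nth (a ^ n) w)"
    unfolding fps_nc_compose_def Abs_ncfps_inverse[OF UNIV_I] N_def[symmetric] fps_compose_nth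
    by (intro sum.cong refl arg_cong2[of _ _ _ _ "(*)"] sum.mono_neutral_left)
      (auto simp: G startsby_zero_power_prefix)
  also have "\<dots> = (\<Sum>n\<le>N. \<Sum>i\<le>N. fps_nth F i * (fps_nth (G ^ i) n * nc_nth (a ^ n) w))"
    by (simp add: sum_distrib_right mult.assoc)
  also have "\<dots> = (\<Sum>i\<le>N. fps_nth F i * nc_nth (fps_nc_compose (G ^ i) a) w)"
    by (subst sum.swap) (simp add: sum_distrib_left fps_nc_compose_def N_def)
  also have "\<dots> = nc_nth (fps_nc_compose F (fps_nc_compose G a)) w"
    by (simp add: fps_nc_compose_power[OF a] fps_nc_compose_def[of F] N_def)
  finally show "nc_nth (fps_nc_compose (F oo G) a) w =
    nc_nth (fps_nc_compose F (fps_nc_compose G a)) w" .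
qed

section \<open>Exponential and logarithm\<close>

text \<open>Integers are central in any ring, so \<open>of_int\<close> multiples serve as scalar
  multiples.\<close>

lemma nc_power_of_int_mult: "(of_int c * a) ^ i = of_int (c ^ i) * (a :: 'a::ring_1) ^ i"
proof (induction i)
  case (Suc i)
  have "(of_int c * a) ^ Suc i = of_int c * (a * of_int (c ^ i)) * a ^ i"
    using Suc by (simp add: mult.assoc)
  also have "\<dots> = of_int c * (of_int (c ^ i) * a) * a ^ i"
    by (simp only: mult_of_int_commute)
  finally show ?case by (simp add: mult.assoc)
qed simp

lemma nc_exp_of_int_mult: "nc_exp (of_int c * a) = fps_nc_compose (fps_exp (of_int c)) a"
  by (rule ncfps_eqI)
    (simp add: nc_exp_def fps_nc_compose_def nc_power_of_int_mult nc_nth_of_int_mult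
      del: of_int_power, simp)

lemma nc_exp_mult_of_int_mult:
  assumes "nc_nth a [] = 0"
  shows "nc_exp (of_int c * a) * nc_exp (of_int d * a) = nc_exp (of_int (c + d) * a)"
  unfolding nc_exp_of_int_mult by (simp add: fps_exp_add_mult fps_nc_compose_mult assms)

lemma nc_exp_0 [simp]: "nc_exp 0 = 1"
  using nc_exp_of_int_mult[of 0 0] by simp

lemma nc_exp_uminus_mult: "nc_nth a [] = 0 \<Longrightarrow> nc_exp (- a) * nc_exp a = 1"
  using nc_exp_mult_of_int_mult[of a "-1" 1] by simp

lemma nc_nth_exp_Nil [simp]: "nc_nth (nc_exp a) [] = 1"
  by (simp add: nc_exp_def)

text \<open>\<open>fps_ln 1\<close> and \<open>fps_exp 1 - 1\<close> are compositional inverses, and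
  this carries over by \<open>fps_nc_compose_compose\<close>.\<close>

lemma nc_log_exp:
  assumes "nc_nth a [] = 0"
  shows "nc_log (nc_exp a) = a"
proof -
  have "nc_log (nc_exp a) = fps_nc_compose (fps_ln 1) (fps_nc_compose (fps_exp 1 - 1) a)"
    by (simp add: nc_log_def nc_exp_def fps_nc_compose_diff)
  also have "\<dots> = fps_nc_compose (fps_ln 1 oo (fps_exp 1 - 1)) a"
    by (rule fps_nc_compose_compose[symmetric]) (simp_all add: assms)
  also have "\<dots> = a"
    by (simp add: fps_ln_fps_exp_inv fps_inv_fps_exp_compose(1) fps_nc_compose_X assms)
  finally show ?thesis .
qed

lemma nc_exp_log:
  assumes "nc_nth g [] = 1"
  shows "nc_exp (nc_log g) = g"
proof -
  have "nc_exp (nc_log g) - 1 = fps_nc_compose (fps_exp 1 - 1) (fps_nc_compose (fps_ln 1) (g - 1))"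
    by (simp add: nc_log_def nc_exp_def fps_nc_compose_diff)
  also have "\<dots> = fps_nc_compose ((fps_exp 1 - 1) oo fps_ln 1) (g - 1)"
    by (rule fps_nc_compose_compose[symmetric]) (simp_all add: assms fps_ln_def)
  also have "\<dots> = g - 1"
    by (simp add: fps_ln_fps_exp_inv fps_inv_fps_exp_compose(2) fps_nc_compose_X assms)
  finally show ?thesis by simp
qed

section \<open>Identities for the Baker--Campbell--Hausdorff series\<close>

declare nc_bch_constant [simp]

lemma nc_exp_bch: "nc_exp (nc_bch a b) = nc_exp a * nc_exp b"
  by (simp add: nc_bch_def nc_exp_log)

lemma nc_bch_assoc: "nc_bch (nc_bch a b) c = nc_bch a (nc_bch b c)"
  by (simp add: nc_bch_def[of "nc_bch a b"] nc_bch_def[of a "nc_bch b c"] nc_exp_bch mult.assoc)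

lemma nc_bch_of_int_mult:
  assumes "nc_nth a [] = 0"
  shows "nc_bch (of_int c * a) (of_int d * a) = of_int (c + d) * a"
  by (simp only: nc_bch_def nc_exp_mult_of_int_mult[OF assms])
    (simp only: nc_log_exp nc_nth_Nil_of_int_mult assms)

lemma nc_bch_self: "nc_nth a [] = 0 \<Longrightarrow> nc_bch a a = 2 * a"
  using nc_bch_of_int_mult[of a 1 1] by simp

text \<open>\<open>nc_exp (- b) * nc_exp (- a)\<close> is inverse to
  \<open>nc_exp a * nc_exp b\<close>, hence it is the exponential of
  \<open>- nc_bch a b\<close>.\<close>

lemma nc_bch_uminus:
  assumes "nc_nth a [] = 0" "nc_nth b [] = 0"
  shows "nc_bch (- b) (- a) = - nc_bch a b"
proof -
  let ?c = "nc_bch a b"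
  have "nc_exp (- ?c) = nc_exp (- b) * (nc_exp (- a) * nc_exp a) * nc_exp b * nc_exp (- ?c)"
    using assms by (simp add: nc_exp_uminus_mult)
  also have "\<dots> = nc_exp (- b) * nc_exp (- a) * (nc_exp ?c * nc_exp (- ?c))"
    by (simp add: nc_exp_bch mult.assoc)
  also have "\<dots> = nc_exp (- b) * nc_exp (- a)"
    using nc_exp_uminus_mult[of "- ?c"] by simp
  finally have "nc_bch (- b) (- a) = nc_log (nc_exp (- ?c))"
    by (simp add: nc_bch_def[of "- b"])
  thus ?thesis by (simp add: nc_log_exp)
qed

lemma nc_subst_bch:
  assumes "nc_nth a [] = 0" "nc_nth b [] = 0" "nc_nth p [] = 0" "nc_nth q [] = 0"
  shows "nc_subst (nc_bch p q) a b = nc_bch (nc_subst p a b) (nc_subst q a b)"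
  by (simp add: assms nc_bch_def nc_log_def nc_exp_def nc_subst_compose nc_subst_diff
      nc_subst_mult nc_subst_1)

section \<open>Homogeneous terms\<close>

lemma nc_nth_uminus_one_power_mult [simp]:
  "nc_nth ((- 1) ^ i * f) w = (- 1) ^ i * nc_nth (f :: 'a::ring_1 ncfps) w"
  using nc_nth_of_int_mult[of "(- 1) ^ i" f w] by simp

lemma nc_nth_numeral_mult [simp]:
  "nc_nth (numeral k * f) w = numeral k * nc_nth (f :: 'a::ring_1 ncfps) w"
  using nc_nth_of_int_mult[of "numeral k" f w] by simp

lemma nc_nth_singleton_compose:
  "nc_nth (fps_nc_compose F a) [x] = fps_nth F 1 * nc_nth a [x]"
  by (simp add: fps_nc_compose_def)

lemma nc_nth_singleton_bch: "nc_nth (nc_bch a b) [x] = nc_nth a [x] + nc_nth b [x]"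
proof -
  have "nc_nth (nc_exp c) [x] = nc_nth c [x]" for c :: "'a ncfps"
    by (simp add: nc_exp_def nc_nth_singleton_compose)
  thus ?thesis
    by (simp add: nc_bch_def nc_log_def nc_nth_singleton_compose fps_ln_def nc_nth_mult add.commute)
qed

text \<open>Only words of length at most \<open>n\<close> reach degree \<open>n\<close>; the sum
  groups them by length.\<close>

lemma nc_hom_subst_sum:
  assumes "nc_nth a [] = 0" "nc_nth b [] = 0"
  shows "nc_hom n (nc_subst f a b) = (\<Sum>m\<le>n. nc_hom n (nc_subst (nc_hom m f) a b))"
proof (rule ncfps_eqI)
  fix w :: "nc_var list"
  have "nc_nth (\<Sum>m\<le>n. nc_hom n (nc_subst (nc_hom m f) a b)) w =
    (if length w = n then \<Sum>u | length u \<le> n. \<Sum>m\<le>n.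
      if length u = m then nc_nth f u * nc_nth (nc_word_eval a b u) w else 0 else 0)"
    by (subst sum.swap) (auto simp: nc_nth_sum nc_subst_def if_distrib[of "\<lambda>x. x * _"] cong: if_cong)
  also have "\<dots> = nc_nth (nc_hom n (nc_subst f a b)) w"
    by (auto simp: nc_subst_def intro!: sum.cong)
  finally show "nc_nth (nc_hom n (nc_subst f a b)) w =
    nc_nth (\<Sum>m\<le>n. nc_hom n (nc_subst (nc_hom m f) a b)) w" ..
qed

lemma nc_word_eval_of_int_mult:
  "nc_word_eval (of_int c * a) (of_int c * b) u = of_int (c ^ length u) * nc_word_eval a b u"
proof (induction u)
  case (Cons x u)
  have *: "of_int c * d * (of_int k * e) = of_int (c * k) * (d * e)" for d e :: "'a ncfps" and k
  proof -
    have "of_int c * d * (of_int k * e) = of_int c * (d * of_int k) * e"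
      by (simp only: mult.assoc)
    also have "\<dots> = of_int c * (of_int k * d) * e"
      by (simp only: mult_of_int_commute)
    finally show ?thesis by (simp add: mult.assoc)
  qed
  show ?case by (cases x) (simp_all only: nc_word_eval.simps Cons * length_Cons power_Suc)
qed simp

text \<open>Each word of length \<open>m\<close> yields \<open>m\<close> factors \<open>c\<close>.
  Used with \<open>c = - 1\<close> for signs and with \<open>c = 2\<close> for the factor
  \<open>2 ^ n\<close>.\<close>

lemma nc_subst_hom_of_int_mult:
  "nc_subst (nc_hom m f) (of_int c * a) (of_int c * b) =
    of_int (c ^ m) * nc_subst (nc_hom m f :: 'a::comm_ring_1 ncfps) a b"
  by (rule ncfps_eqI)
    (auto simp: nc_subst_def nc_word_eval_of_int_mult nc_nth_of_int_mult sum_distrib_left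
      simp del: of_int_power intro!: sum.cong)

lemma nc_word_eval_linear_eq_0:
  assumes "nc_hom 1 a = a" "nc_hom 1 b = b" "length w \<noteq> length u"
  shows "nc_nth (nc_word_eval a b u) w = 0"
  using assms(3)
proof (induction u arbitrary: w)
  case (Cons x u)
  have *: "nc_nth (c * nc_word_eval a b u) w = 0" if c: "nc_hom 1 c = c" for c
    unfolding nc_nth_mult
  proof (rule sum.neutral, rule ballI)
    fix i assume i: "i \<in> {0..length w}"
    show "nc_nth c (take i w) * nc_nth (nc_word_eval a b u) (drop i w) = 0"
    proof (cases "i = 1")
      case True
      thus ?thesis using Cons.IH[of "drop i w"] Cons.prems i by auto
    next
      case False
      thus ?thesis using arg_cong[OF c, of "\<lambda>c. nc_nth c (take i w)"] i by simp
    qed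
  qed
  show ?case using assms(1,2) by (cases x) (simp_all add: *)
qed simp

text \<open>A product of \<open>length u\<close> linear forms is homogeneous of degree
  \<open>length u\<close>, so linear substitutions preserve degree.\<close>

lemma nc_hom_subst_linear:
  assumes "nc_hom 1 a = a" "nc_hom 1 b = b"
  shows "nc_hom n (nc_subst f a b) = nc_subst (nc_hom n f) a b"
  by (rule ncfps_eqI) (auto simp: nc_subst_def nc_word_eval_linear_eq_0[OF assms]
      intro!: sum.cong sum.neutral sum.neutral[symmetric])

text \<open>The factor \<open>c\<close> must take exactly one letter: taking none meets its zero
  constant term, taking more leaves a word shorter than \<open>u\<close>.\<close>

lemma nc_nth_mult_word_eval:
  assumes "nc_nth c [] = 0" "nc_nth a [] = 0" "nc_nth b [] = 0" "length w = length u"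
  shows "nc_nth (c * nc_word_eval a b u) (x # w) = nc_nth c [x] * nc_nth (nc_word_eval a b u) w"
proof -
  have "nc_nth (c * nc_word_eval a b u) (x # w) = (\<Sum>i=0..length (x # w).
      if i = 1 then nc_nth c [x] * nc_nth (nc_word_eval a b u) w else 0)"
    unfolding nc_nth_mult
  proof (rule sum.cong[OF refl])
    fix i :: nat
    assume i: "i \<in> {0..length (x # w)}"
    show "nc_nth c (take i (x # w)) * nc_nth (nc_word_eval a b u) (drop i (x # w)) =
        (if i = 1 then nc_nth c [x] * nc_nth (nc_word_eval a b u) w else 0)"
    proof (cases "i > 1")
      case True
      hence "length (drop i (x # w)) < length u" using i assms(4) by simp
      thus ?thesis using True by (simp add: nc_word_eval_eq_0 assms(2,3))
    next
      case False
      hence "i = 0 \<or> i = 1" by linarith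
      thus ?thesis using assms(1) by auto
    qed
  qed
  thus ?thesis by (simp add: Suc_le_eq del: sum.atLeast0_atMost_Suc)
qed

lemma nc_nth_word_eval_cong:
  assumes "nc_nth a [] = 0" "nc_nth b [] = 0" "nc_nth a' [] = 0" "nc_nth b' [] = 0"
    and "\<And>x. nc_nth a [x] = nc_nth a' [x]" "\<And>x. nc_nth b [x] = nc_nth b' [x]"
    and "length w = length u"
  shows "nc_nth (nc_word_eval a b u) w = nc_nth (nc_word_eval a' b' u) w"
  using assms(7)
proof (induction u arbitrary: w)
  case (Cons x u)
  then obtain y v where w: "w = y # v" and v: "length v = length u"
    by (cases w) auto
  show ?case
    by (cases x) (simp_all add: w v nc_nth_mult_word_eval assms(1-6) Cons.IH[OF v])
qed simp

lemma nc_hom_1_ncX [simp]: "nc_hom 1 ncX = ncX"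
  and nc_hom_1_ncY [simp]: "nc_hom 1 ncY = ncY"
  by (rule ncfps_eqI, simp)+

lemma nc_nth_word_eval_ncX_ncY:
  "nc_nth (nc_word_eval ncX ncY u) w = (if u = w then 1 else 0)"
proof (cases "length w = length u")
  case True
  thus ?thesis
  proof (induction u arbitrary: w)
    case (Cons x u)
    then obtain y v where w: "w = y # v" and v: "length v = length u"
      by (cases w) auto
    show ?case
      by (cases x; cases y) (auto simp: w v nc_nth_mult_word_eval Cons.IH[OF v])
  qed simp
qed (auto simp: nc_word_eval_linear_eq_0 simp del: One_nat_def)

lemma nc_subst_ncX_ncY [simp]: "nc_subst f ncX ncY = f"
  by (rule ncfps_eqI)
    (simp add: nc_subst_def nc_nth_word_eval_ncX_ncY if_distrib[of "\<lambda>x. _ * x"] cong: if_cong)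

section \<open>Terms of the composed series\<close>

text \<open>\<langle>a,b\<rangle> is the composite of \<langle>X,Y\<rangle>, which is split by
  degree before substituting; its constant term is zero, so the sum starts at 1.\<close>

lemma nc_hom_bch_eq_sum:
  assumes "nc_nth a [] = 0" "nc_nth b [] = 0"
  shows "nc_hom n (nc_bch a b) = (\<Sum>m=1..n. nc_hom n (nc_bch_term m a b))"
proof -
  have "nc_bch a b = nc_subst (nc_bch ncX ncY) a b"
    by (simp add: nc_subst_bch nc_subst_ncX nc_subst_ncY assms)
  hence "nc_hom n (nc_bch a b) = (\<Sum>m\<le>n. nc_hom n (nc_bch_term m a b))"
    by (simp only: nc_bch_term_def) (rule nc_hom_subst_sum[OF assms])
  also have "\<dots> = (\<Sum>m=1..n. nc_hom n (nc_bch_term m a b))"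
  proof (rule sum.mono_neutral_right)
    have "nc_hom 0 (nc_bch ncX ncY) = (0 :: 'a ncfps)"
      by (rule ncfps_eqI) auto
    hence "nc_hom n (nc_bch_term 0 a b) = 0"
      by (intro ncfps_eqI) (simp add: nc_bch_term_def)
    thus "\<forall>m\<in>{..n} - {1..n}. nc_hom n (nc_bch_term m a b) = 0"
      by (metis DiffE One_nat_def Suc_leI atLeastAtMost_iff atMost_iff gr0I)
  qed auto
  finally show ?thesis .
qed

lemma nc_bch_term_1:
  assumes "nc_nth a [] = 0" "nc_nth b [] = 0"
  shows "nc_bch_term 1 a b = a + b"
proof -
  have "nc_hom 1 (nc_bch ncX ncY) = (ncX + ncY :: 'a ncfps)"
    by (rule ncfps_eqI) (auto simp: nc_nth_singleton_bch length_Suc_conv split: if_splits)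
  thus ?thesis
    by (simp only: nc_bch_term_def nc_subst_add nc_subst_ncX[OF assms] nc_subst_ncY[OF assms])
qed

lemma nc_bch_term_uminus: "nc_bch_term m (- a) (- b) = (- 1) ^ m * nc_bch_term m a b"
  using nc_subst_hom_of_int_mult[of m _ "- 1" a b] by (simp add: nc_bch_term_def)

lemma nc_hom_of_int_mult: "nc_hom n (of_int c * f) = of_int c * nc_hom n f"
  by (rule ncfps_eqI) (simp add: nc_nth_of_int_mult)

lemma nc_hom_uminus: "nc_hom n (- f) = - nc_hom n f"
  by (rule ncfps_eqI) simp

lemma nc_hom_subst_uminus:
  fixes f :: "'a::comm_ring_1 ncfps"
  shows "nc_hom n (nc_subst f (- ncX) (- ncY)) = (- 1) ^ n * nc_hom n f"
  using nc_subst_hom_of_int_mult[of n f "- 1" ncX ncY]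
  by (simp add: nc_hom_subst_linear nc_hom_uminus del: One_nat_def)

text \<open>Since \<langle>Y,X\<rangle> = -\<langle>-X,-Y\<rangle>, swapping the variables
  multiplies the degree \<open>m\<close> term by \<open>- (- 1) ^ m\<close>; then \<open>a\<close>,
  \<open>b\<close> are substituted.\<close>

lemma nc_bch_term_commute:
  assumes "nc_nth a [] = 0" "nc_nth b [] = 0"
  shows "nc_bch_term m b a = (- 1) ^ (m + 1) * nc_bch_term m a b"
proof -
  let ?B = "nc_bch ncX ncY :: 'a ncfps"
  have "nc_subst (nc_hom m ?B) ncY ncX = nc_hom m (nc_bch ncY ncX)"
    by (simp add: nc_hom_subst_linear[symmetric] nc_subst_bch nc_subst_ncX nc_subst_ncY del: One_nat_def)
  also have "nc_bch ncY ncX = - nc_bch (- ncX) (- ncY :: 'a ncfps)"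
    by (simp add: nc_bch_uminus)
  also have "nc_bch (- ncX) (- ncY :: 'a ncfps) = nc_subst ?B (- ncX) (- ncY)"
    by (simp add: nc_subst_bch nc_subst_ncX nc_subst_ncY)
  finally have *: "nc_subst (nc_hom m ?B) ncY ncX = (- 1) ^ (m + 1) * nc_hom m ?B"
    by (simp add: nc_hom_uminus nc_hom_subst_uminus)
  have "nc_bch_term m b a = nc_subst (nc_subst (nc_hom m ?B) ncY ncX) a b"
    by (simp add: nc_bch_term_def nc_subst_subst nc_subst_ncX nc_subst_ncY assms)
  also have "\<dots> = (- 1) ^ (m + 1) * nc_bch_term m a b"
    unfolding * nc_bch_term_def
    by (rule ncfps_eqI) (simp add: nc_subst_def sum_distrib_left sum_negf mult.assoc del: nc_nth_hom)
  finally show ?thesis .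
qed

lemma nc_subst_bch_term:
  assumes "nc_nth a [] = 0" "nc_nth b [] = 0" "nc_nth c [] = 0" "nc_nth d [] = 0"
  shows "nc_subst (nc_bch_term m a b) c d = nc_bch_term m (nc_subst a c d) (nc_subst b c d)"
  unfolding nc_bch_term_def by (rule nc_subst_subst) fact+

text \<open>Words of length \<open>n\<close> evaluated in degree \<open>n\<close>, the lowest
  possible one, see only the linear parts of the substituted series.\<close>

lemma nc_hom_bch_term_cong:
  assumes "nc_nth a [] = 0" "nc_nth b [] = 0" "nc_nth a' [] = 0" "nc_nth b' [] = 0"
    and "\<And>x. nc_nth a [x] = nc_nth a' [x]" "\<And>x. nc_nth b [x] = nc_nth b' [x]"
  shows "nc_hom n (nc_bch_term n a b) = nc_hom n (nc_bch_term n a' b')"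
proof (rule ncfps_eqI)
  fix w
  show "nc_nth (nc_hom n (nc_bch_term n a b)) w = nc_nth (nc_hom n (nc_bch_term n a' b')) w"
    by (auto simp: nc_bch_term_def nc_subst_def nc_nth_word_eval_cong[OF assms] intro!: sum.cong)
qed

theorem mainTheorem2:
  fixes n :: nat
    and P0 P1 :: "'k::field_char_0 ncfps"
  assumes "n > 2"
    and "of_int (2 ^ n - (-1) ^ n - 3) * P0 =
      (\<Sum>m | 1 < m \<and> m < n \<and> [m = n] (mod 2).
        nc_hom n (nc_bch_term m ncX (nc_bch (nc_bch ncX ncY) ncY))
        - nc_hom n (nc_bch_term m ncX (nc_bch (nc_bch ncY ncX) ncY)))"
    and "of_int (2 ^ n - (-1) ^ n - 3) * P1 =
      (\<Sum>m | 1 < m \<and> m < n \<and> [m = n + 1] (mod 2).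
        2 * nc_W n m + (-1) ^ (n + 1) * nc_subst (nc_W n m) (2 * ncY) ncX)"
  shows "nc_hom n (nc_bch ncX ncY) = P0 + P1"
proof (rule ncfps_eqI)
  fix w :: "nc_var list"
  let ?X = "ncX :: 'k ncfps" and ?Y = "ncY :: 'k ncfps"
  define T where "T = nc_bch ?X ?Y"
  define Z where "Z = nc_bch (nc_bch ?Y ?X) ?Y"
  \<comment> \<open>This sign change acts as \<open>(- 1) ^ n\<close> in degree \<open>n\<close>;
    together with \<open>nc_bch_uminus\<close> it yields the reversal symmetry.\<close>
  define \<epsilon> where "\<epsilon> f = nc_subst f (- ?X) (- ?Y)" for f
  \<comment> \<open>Everything is compared at the one word \<open>w\<close>, so the identities
    become linear relations between elements of the field.\<close>
  define \<pi> where "\<pi> f = nc_nth (nc_hom n f) w" for f :: "'k ncfps"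
  define U where "U m = \<pi> (nc_bch_term m ?X (nc_bch T ?Y))" for m
  define V where "V m = \<pi> (nc_bch_term m ?X Z)" for m
  define W where "W m = \<pi> (nc_bch_term m T ?Y)" for m

  have const [simp]: "nc_nth T [] = 0" "nc_nth Z [] = 0" "nc_nth (2 * ?X) [] = 0" "nc_nth (2 * ?Y) [] = 0"
    by (simp_all add: T_def Z_def)
  have linear: "nc_hom 1 (2 * ?X) = 2 * ?X" "nc_hom 1 (2 * ?Y) = 2 * ?Y"
    using nc_hom_of_int_mult[of 1 2 ?X] nc_hom_of_int_mult[of 1 2 ?Y] by (simp_all del: One_nat_def)
  have \<epsilon>_XY: "\<epsilon> ?X = - ?X" "\<epsilon> ?Y = - ?Y"
    by (simp_all add: \<epsilon>_def nc_subst_ncX nc_subst_ncY)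
  have \<epsilon>_bch: "\<epsilon> (nc_bch a b) = nc_bch (\<epsilon> a) (\<epsilon> b)" if "nc_nth a [] = 0" "nc_nth b [] = 0" for a b
    using that by (simp add: \<epsilon>_def nc_subst_bch)
  have \<epsilon>_term: "\<epsilon> (nc_bch_term m a b) = nc_bch_term m (\<epsilon> a) (\<epsilon> b)"
    if "nc_nth a [] = 0" "nc_nth b [] = 0" for m a b
    using that by (simp add: \<epsilon>_def nc_subst_bch_term)
  have \<pi>_\<epsilon>: "\<pi> (\<epsilon> f) = (- 1) ^ n * \<pi> f" for f
    by (simp add: \<pi>_def \<epsilon>_def nc_hom_subst_uminus del: nc_nth_hom)
  have \<pi>_sign: "\<pi> ((- 1) ^ i * f) = (- 1) ^ i * \<pi> f" for i f
    by (simp add: \<pi>_def)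
  have \<pi>_lin: "\<pi> (f + g) = \<pi> f + \<pi> g" "\<pi> (- f) = - \<pi> f" "\<pi> (2 * f) = 2 * \<pi> f" for f g
    by (simp_all add: \<pi>_def)
  have \<pi>_XY: "\<pi> ?X = 0" "\<pi> ?Y = 0"
    using assms(1) by (auto simp: \<pi>_def)
  have \<pi>_sum: "\<pi> (nc_bch a b) = (\<Sum>m=1..n. \<pi> (nc_bch_term m a b))"
    if "nc_nth a [] = 0" "nc_nth b [] = 0" for a b
    by (simp only: \<pi>_def nc_hom_bch_eq_sum[OF that] nc_nth_sum)

  have TY: "nc_bch T ?Y = nc_bch ?X (2 * ?Y)"
    by (simp add: T_def nc_bch_assoc nc_bch_self)
  have Z': "Z = nc_bch ?Y T"
    by (simp add: Z_def T_def nc_bch_assoc)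
  \<comment> \<open>Reversing twice turns \<langle>-Y,\<langle>-X,-Y\<rangle>\<rangle> into
    -\<langle>\<langle>Y,X\<rangle>,Y\<rangle>, and associativity identifies the two
    bracketings.\<close>
  have \<epsilon>_Z: "\<epsilon> Z = - Z"
    unfolding Z' by (simp add: \<epsilon>_bch \<epsilon>_XY T_def nc_bch_uminus)
      (simp add: nc_bch_uminus nc_bch_assoc flip: T_def)

  \<comment> \<open>The substitution turns \<open>T\<close> into \<langle>2Y,X\<rangle>, which
    \<open>\<epsilon>\<close> sends to -\<langle>X,2Y\<rangle> = -\<langle>T,Y\<rangle>. Pulling out
    the signs and swapping the arguments costs \<open>(- 1) ^ m * (- 1) ^ (m + 1)\<close>, which is
    -1 for every \<open>m\<close>.\<close>
  have U_eq: "U m = (- 1) ^ (n + 1) * nc_nth (nc_subst (nc_W n m) (2 * ?Y) ?X) w" for m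
  proof -
    let ?R = "nc_bch (2 * ?Y) ?X"
    have "nc_nth (nc_subst (nc_W n m) (2 * ?Y) ?X) w = \<pi> (nc_subst (nc_bch_term m T ?Y) (2 * ?Y) ?X)"
      unfolding nc_W_def \<pi>_def T_def by (subst nc_hom_subst_linear) (simp_all add: linear del: One_nat_def)
    also have "nc_subst (nc_bch_term m T ?Y) (2 * ?Y) ?X = nc_bch_term m ?R ?X"
      by (simp add: nc_subst_bch_term T_def nc_subst_bch nc_subst_ncX nc_subst_ncY)
    finally have *: "nc_nth (nc_subst (nc_W n m) (2 * ?Y) ?X) w = \<pi> (nc_bch_term m ?R ?X)" .
    have "\<epsilon> ?R = - nc_bch ?X (2 * ?Y)"
    proof -
      have "\<epsilon> (2 * ?Y) = - (2 * ?Y)"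
        unfolding mult_2 by (simp add: \<epsilon>_def nc_subst_add nc_subst_ncY)
      thus ?thesis by (simp add: \<epsilon>_bch \<epsilon>_XY nc_bch_uminus)
    qed
    hence "\<epsilon> (nc_bch_term m ?R ?X) = nc_bch_term m (- nc_bch T ?Y) (- ?X)"
      by (simp add: \<epsilon>_term \<epsilon>_XY TY)
    also have "\<dots> = (- 1) ^ m * ((- 1) ^ (m + 1) * nc_bch_term m ?X (nc_bch T ?Y))"
      by (simp add: nc_bch_term_uminus nc_bch_term_commute[of ?X "nc_bch T ?Y"])
    finally have "\<epsilon> (nc_bch_term m ?R ?X) = \<dots>" .
    from arg_cong[OF this, of \<pi>] have "(- 1) ^ n * \<pi> (nc_bch_term m ?R ?X) = - U m"
      unfolding \<pi>_\<epsilon> \<pi>_sign U_def by (simp flip: power_add mult.assoc)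
    thus ?thesis unfolding * by simp
  qed

  \<comment> \<open>\<open>\<epsilon>\<close> negates both \<open>?X\<close> and \<open>Z\<close>,
    which gives \<open>(- 1) ^ m\<close>, while degree \<open>n\<close> gives
    \<open>(- 1) ^ n\<close>.\<close>
  have V_sym: "V m = (- 1) ^ (n + m) * V m" for m
  proof -
    have "\<epsilon> (nc_bch_term m ?X Z) = (- 1) ^ m * nc_bch_term m ?X Z"
      by (simp add: \<epsilon>_term \<epsilon>_XY \<epsilon>_Z nc_bch_term_uminus)
    from arg_cong[OF this, of \<pi>] have "(- 1) ^ n * V m = (- 1) ^ m * V m"
      by (simp only: \<pi>_\<epsilon> \<pi>_sign V_def)
    thus ?thesis by (cases "even n"; cases "even m") simp_all
  qed
  have Z_sym: "\<pi> Z = (- 1) ^ (n + 1) * \<pi> Z"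
    using \<pi>_\<epsilon>[of Z] by (cases "even n") (simp_all add: \<epsilon>_Z \<pi>_lin)

  have sum_U: "(\<Sum>m=1..n. U m) = 2 ^ n * \<pi> T"
  proof -
    have "nc_bch ?X (nc_bch T ?Y) = nc_bch (2 * ?X) (2 * ?Y)"
      by (simp add: TY nc_bch_self flip: nc_bch_assoc)
    also have "\<dots> = nc_subst T (2 * ?X) (2 * ?Y)"
      by (simp add: T_def nc_subst_bch nc_subst_ncX nc_subst_ncY)
    finally have "\<pi> (nc_bch ?X (nc_bch T ?Y)) = nc_nth (nc_subst (nc_hom n T) (2 * ?X) (2 * ?Y)) w"
      by (simp add: \<pi>_def nc_hom_subst_linear[OF linear] del: nc_nth_hom)
    also have "\<dots> = 2 ^ n * \<pi> T"
      using nc_subst_hom_of_int_mult[of n T 2 ?X ?Y]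
      by (simp add: \<pi>_def nc_nth_of_int_mult del: of_int_power)
    finally show ?thesis by (simp add: U_def \<pi>_sum)
  qed
  have sum_V: "(\<Sum>m=1..n. V m) = 2 * \<pi> T"
  proof -
    have "nc_bch ?X Z = 2 * T"
      using nc_bch_self[of T] by (simp add: Z' T_def nc_bch_assoc)
    thus ?thesis using \<pi>_sum[of ?X Z] by (simp add: V_def \<pi>_lin)
  qed
  \<comment> \<open>Both sides are the degree \<open>n\<close> part of \<langle>T,Y\<rangle>: in
    \<open>U 1\<close> the summand \<open>?X\<close> has degree 1 and drops out.\<close>
  have sum_W: "(\<Sum>m=1..n. W m) = U 1"
    by (simp add: W_def U_def \<pi>_sum nc_bch_term_1 \<pi>_lin \<pi>_XY del: One_nat_def)
  have sum_W': "(\<Sum>m=1..n. (- 1) ^ (m + 1) * W m) = \<pi> Z"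
  proof -
    have "\<pi> (nc_bch_term m ?Y T) = (- 1) ^ (m + 1) * W m" for m
      using nc_bch_term_commute[of T ?Y m] \<pi>_sign[of "m + 1" "nc_bch_term m T ?Y"]
      by (simp add: W_def)
    thus ?thesis using \<pi>_sum[of ?Y T] by (simp add: Z')
  qed
  have V1: "V 1 = \<pi> Z"
    by (simp add: V_def nc_bch_term_1 \<pi>_lin \<pi>_XY del: One_nat_def)
  have W1: "W 1 = \<pi> T"
    by (simp add: W_def nc_bch_term_1 \<pi>_lin \<pi>_XY del: One_nat_def)
  \<comment> \<open>Both inner series have linear part X + 2Y.\<close>
  have Un: "U n = V n"
    unfolding U_def V_def \<pi>_def
    by (rule arg_cong[where f = "\<lambda>f. nc_nth f w"], rule nc_hom_bch_term_cong)
      (simp_all add: nc_nth_singleton_bch T_def Z_def)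

  define M0 where "M0 = {m. 1 < m \<and> m < n \<and> [m = n] (mod 2)}"
  define M1 where "M1 = {m. 1 < m \<and> m < n \<and> [m = n + 1] (mod 2)}"
  have fin: "finite M0" "finite M1"
    by (auto simp: M0_def M1_def)
  have parity: "even m = even n" if "m \<in> M0" for m
    using that by (auto simp: M0_def cong_def even_iff_mod_2_eq_zero)
  have parity': "even m = odd n" if "m \<in> M1" for m
    using that by (auto simp: M1_def cong_def mod_Suc even_iff_mod_2_eq_zero split: if_splits)
  \<comment> \<open>The end points 1 and \<open>n\<close> lie in neither \<open>M0\<close> nor
    \<open>M1\<close> and are split off separately.\<close>
  have "{1..n} = insert 1 (insert n (M0 \<union> M1))"
    using assms(1) by (auto simp: M0_def M1_def cong_def) presburger
  moreover have "M0 \<inter> M1 = {}"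
    using parity parity' by blast
  ultimately have split: "(\<Sum>m=1..n. h m) = h 1 + h n + (\<Sum>m\<in>M0. h m) + (\<Sum>m\<in>M1. h m)"
    for h :: "nat \<Rightarrow> 'k"
    using assms(1) fin by (simp add: sum.union_disjoint M0_def M1_def add.assoc)

  have V_M1: "(\<Sum>m\<in>M1. V m) = 0"
  proof (rule sum.neutral, rule ballI)
    fix m assume "m \<in> M1"
    hence "V m = - V m" using V_sym[of m] parity'[of m] by (cases "even n") auto
    thus "V m = 0" by simp
  qed
  have W'_M0: "(\<Sum>m\<in>M0. (- 1) ^ (m + 1) * W m) = (- 1) ^ (n + 1) * (\<Sum>m\<in>M0. W m)"
    unfolding sum_distrib_left
    by (rule sum.cong[OF refl]) (use parity in \<open>auto simp: minus_one_power_iff\<close>)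
  have W'_M1: "(\<Sum>m\<in>M1. (- 1) ^ (m + 1) * W m) = (- 1) ^ n * (\<Sum>m\<in>M1. W m)"
    unfolding sum_distrib_left
    by (rule sum.cong[OF refl]) (use parity' in \<open>auto simp: minus_one_power_iff\<close>)

  have P0: "of_int (2 ^ n - (- 1) ^ n - 3) * nc_nth P0 w = (\<Sum>m\<in>M0. U m) - (\<Sum>m\<in>M0. V m)"
    using arg_cong[OF assms(2), of "\<lambda>f. nc_nth f w"]
    unfolding nc_nth_of_int_mult nc_nth_sum M0_def[symmetric]
    by (simp add: U_def V_def T_def Z_def \<pi>_def sum_subtractf)
  have P1: "of_int (2 ^ n - (- 1) ^ n - 3) * nc_nth P1 w = 2 * (\<Sum>m\<in>M1. W m) + (\<Sum>m\<in>M1. U m)"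
    using arg_cong[OF assms(3), of "\<lambda>f. nc_nth f w"]
    unfolding nc_nth_of_int_mult nc_nth_sum M1_def[symmetric] nc_nth_simps
      nc_nth_uminus_one_power_mult U_eq[symmetric]
    by (simp add: W_def T_def \<pi>_def nc_W_def sum.distrib sum_distrib_left)

  have "of_int (2 ^ n - (- 1) ^ n - 3) * (nc_nth P0 w + nc_nth P1 w) =
      of_int (2 ^ n - (- 1) ^ n - 3) * \<pi> T"
  proof -
    note sums = sum_U[unfolded split] sum_V[unfolded split V_M1 V1] sum_W[unfolded split W1]
      sum_W'[unfolded split W'_M0 W'_M1 W1]
    \<comment> \<open>\<open>U 1\<close> and \<open>\<pi> Z\<close> are the plain and the
      alternating sum of the \<open>W m\<close>. For odd \<open>n\<close> their difference is twice
      the sum over even \<open>m\<close>, that is over \<open>M1\<close>. For even \<open>n\<close>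
      the alternating sum is zero, so the odd indices, namely 1 and those in \<open>M1\<close>, give
      half of \<open>U 1\<close>.\<close>
    have "2 * (\<Sum>m\<in>M1. W m) + \<pi> Z - U 1 = - ((- 1) ^ n + 1) * \<pi> T"
    proof (cases "even n")
      case True
      hence Z: "\<pi> Z = 0" using Z_sym by simp
      have "U 1 = (W n + (\<Sum>m\<in>M0. W m)) + (\<pi> T + (\<Sum>m\<in>M1. W m))"
        unfolding sums(3)[symmetric] by (simp add: algebra_simps)
      also have "W n + (\<Sum>m\<in>M0. W m) = \<pi> T + (\<Sum>m\<in>M1. W m)"
        using sums(4) True Z by (simp add: algebra_simps)
      finally show ?thesis using True Z by (simp add: algebra_simps)
    next
      case False
      thus ?thesis unfolding sums(3,4)[symmetric] by (simp add: algebra_simps)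
    qed
    hence W_M1: "2 * (\<Sum>m\<in>M1. W m) = U 1 - \<pi> Z - ((- 1) ^ n + 1) * \<pi> T"
      by (simp add: algebra_simps)
    have U_M0: "(\<Sum>m\<in>M0. U m) = 2 ^ n * \<pi> T - U 1 - V n - (\<Sum>m\<in>M1. U m)"
      unfolding sums(1)[symmetric] Un by simp
    have V_M0: "(\<Sum>m\<in>M0. V m) = 2 * \<pi> T - \<pi> Z - V n"
      unfolding sums(2)[symmetric] by simp
    \<comment> \<open>\<open>U 1\<close>, \<open>\<pi> Z\<close>, \<open>V n\<close> and the sum of
      \<open>U\<close> over \<open>M1\<close> cancel, which leaves the coefficient
      \<open>2 ^ n - 2 - ((- 1) ^ n + 1)\<close>.\<close>
    show ?thesis
      unfolding distrib_left P0 P1 W_M1 U_M0 V_M0 by (simp add: algebra_simps)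
  qed
  moreover have "(of_int (2 ^ n - (- 1) ^ n - 3) :: 'k) \<noteq> 0"
    unfolding of_int_eq_0_iff by (rule bch_factor_nonzero[OF assms(1)])
  ultimately show "nc_nth (nc_hom n (nc_bch ncX ncY)) w = nc_nth (P0 + P1) w"
    by (simp add: \<pi>_def T_def)
qed

end
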